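(* Let $E$ be a finite set, $r:2^E\to\mathbb{Z}$ any function, $R$ a commutative ring with $1$, and $m_1,m_2:2^E\to R$ two functions; let $m_1m_2$ denote their pointwise product. Let $t,s$ and $u_e,v_e$ ($e\in E$) be indeterminates. Then, in $R[t^{\pm1},s^{\pm1},u_e,v_e : e\in E]$, $$\mathbf{Z}_{(E,r,m_1m_2)}\bigl(ts,\ (u_ev_e)_{e\in E}\bigr)=\sum_{A\subseteq E} s^{-r(A)}\Bigl(\prod_{e\in A}(-v_e)\Bigr)\,\mathbf{Z}_{(E,r,m_1)|A}\bigl(t,(-u_e)_{e\in A}\bigr)\,\mathbf{Z}_{(E,r,m_2)/A}\bigl(s,(v_e)_{e\in E\setminus A}\bigr).$$
   Context: A ranked set with multiplicity (rsm) is a triple $\mathcal{M}=(E,r,m)$ with $E$ a finite set, $r:2^E\to\mathbb{Z}$ an arbitrary function ($r(\emptyset)$ may be nonzero) and $m:2^E\to R$ an arbitrary function. Its multivariate Tutte polynomial is $\mathbf{Z}_{\mathcal{M}}(q,(v_e)_{e\in E})=\sum_{A\subseteq E} m(A)\,q^{-r(A)}\prod_{e\in A}v_e$ (empty product $=1$). For $A\subseteq E$, the restriction $\mathcal{M}|A$ is the rsm $(A, r|_{2^A}, m|_{2^A})$, and the contraction $\mathcal{M}/A$ is the rsm $(E\setminus A, r', m')$ with $r'(B)=r(B\cup A)-r(A)$ and $m'(B)=m(B\cup A)$ for $B\subseteq E\setminus A$. *)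

theory Defs
  imports "HOL-Library.Poly_Mapping" "HOL-Library.Product_Plus" "HOL-Library.FuncSet"
begin

text \<open>
  Ranked sets with multiplicity. Rank and multiplicity are total functions on \<^typ>\<open>'e set\<close>,
  but only their values on subsets of the ground set matter; finiteness of the ground set is
  stated separately.
\<close>

datatype ('e, 'r) rsm =
  RSM (ground: "'e set") (rank: "'e set \<Rightarrow> int") (mlt: "'e set \<Rightarrow> 'r")

definition rsm_restrict :: "('e, 'r) rsm \<Rightarrow> 'e set \<Rightarrow> ('e, 'r) rsm" where
  "rsm_restrict M A = RSM A (restrict (rank M) (Pow A)) (restrict (mlt M) (Pow A))"

definition rsm_contract :: "('e, 'r) rsm \<Rightarrow> 'e set \<Rightarrow> ('e, 'r) rsm" where
  "rsm_contract M A =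
     RSM (ground M - A)
       (\<lambda>B \<in> Pow (ground M - A). rank M (B \<union> A) - rank M A)
       (\<lambda>B \<in> Pow (ground M - A). mlt M (B \<union> A))"

text \<open>
  The ring $R[q^{\pm 1}, v_e]$ as a monoid algebra: the exponent \<open>(k, n)\<close> stands for the
  monomial $q^k \prod_e v_e^{n(e)}$.
\<close>

type_synonym ('e, 'r) qv_poly = "(int \<times> ('e \<Rightarrow>\<^sub>0 nat)) \<Rightarrow>\<^sub>0 'r"

definition tutte :: "('e, 'r::comm_ring_1) rsm \<Rightarrow> ('e, 'r) qv_poly" where
  "tutte M = (\<Sum>A \<in> Pow (ground M).
     Poly_Mapping.single (- rank M A, \<Sum>e\<in>A. Poly_Mapping.single e 1) (mlt M A))"

text \<open>Integer powers of a unit; for negative \<open>k\<close> this is meaningful only if \<open>x dvd 1\<close>.\<close>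

definition unit_powi :: "'a::comm_ring_1 \<Rightarrow> int \<Rightarrow> 'a" where
  "unit_powi x k = (if 0 \<le> k then x ^ nat k else (THE y. x * y = 1) ^ nat (- k))"

definition Const :: "'r::zero \<Rightarrow> ('k::zero \<Rightarrow>\<^sub>0 'r)" where
  "Const c = Poly_Mapping.single 0 c"

text \<open>
  Evaluation of a polynomial in $R[q^{\pm 1}, v_e]$ at a unit \<open>q\<close> and a family \<open>v\<close> of elements
  of a monoid algebra over the same coefficient ring.
\<close>

definition qv_subst ::
  "('e, 'r::comm_ring_1) qv_poly \<Rightarrow> ('k::comm_monoid_add \<Rightarrow>\<^sub>0 'r) \<Rightarrow> ('e \<Rightarrow> ('k \<Rightarrow>\<^sub>0 'r)) \<Rightarrow> ('k \<Rightarrow>\<^sub>0 'r)"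
where
  "qv_subst p q v = (\<Sum>k \<in> Poly_Mapping.keys p.
     Const (Poly_Mapping.lookup p k) * unit_powi q (fst k) *
     (\<Prod>e \<in> Poly_Mapping.keys (snd k). v e ^ Poly_Mapping.lookup (snd k) e))"

definition tutte_at ::
  "('e, 'r::comm_ring_1) rsm \<Rightarrow> ('k::comm_monoid_add \<Rightarrow>\<^sub>0 'r) \<Rightarrow> ('e \<Rightarrow> ('k \<Rightarrow>\<^sub>0 'r)) \<Rightarrow> ('k \<Rightarrow>\<^sub>0 'r)"
where
  "tutte_at M q v = qv_subst (tutte M) q v"

text \<open>
  The ring $R[t^{\pm 1}, s^{\pm 1}, u_e, v_e]$: the exponent \<open>(i, j, a, b)\<close> stands for
  $t^i s^j \prod_e u_e^{a(e)} v_e^{b(e)}$. There is one pair of indeterminates for each element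
  of the type \<^typ>\<open>'e\<close>; only those with index in the ground set occur in Tutte polynomials.
\<close>

type_synonym ('e, 'r) tsuv_poly =
  "(int \<times> int \<times> ('e \<Rightarrow>\<^sub>0 nat) \<times> ('e \<Rightarrow>\<^sub>0 nat)) \<Rightarrow>\<^sub>0 'r"

definition Var_t :: "('e, 'r::comm_ring_1) tsuv_poly" where
  "Var_t = Poly_Mapping.single (1, 0, 0, 0) 1"

definition Var_s :: "('e, 'r::comm_ring_1) tsuv_poly" where
  "Var_s = Poly_Mapping.single (0, 1, 0, 0) 1"

definition Var_u :: "'e \<Rightarrow> ('e, 'r::comm_ring_1) tsuv_poly" where
  "Var_u e = Poly_Mapping.single (0, 0, Poly_Mapping.single e 1, 0) 1"

definition Var_v :: "'e \<Rightarrow> ('e, 'r::comm_ring_1) tsuv_poly" where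
  "Var_v e = Poly_Mapping.single (0, 0, 0, Poly_Mapping.single e 1) 1"

lemma the_unit_inverse:
  fixes x y :: "'a::comm_ring_1"
  assumes xy: "x * y = 1"
  shows "(THE z. x * z = 1) = y"
proof (rule the_equality)
  show "x * y = 1" by (rule xy)
next
  fix z assume xz: "x * z = 1"
  have "z = (x * y) * z" by (simp add: xy)
  also have "\<dots> = y * (x * z)" by (simp only: ac_simps)
  finally show "z = y" by (simp add: xz)
qed

lemma unit_powi_Var_t: "unit_powi Var_t k = Poly_Mapping.single (k, 0, 0, 0) 1"
proof -
  have pow: "Poly_Mapping.single (i, 0, 0, 0) (1::'b) ^ n =
      (Poly_Mapping.single (int n * i, 0, 0, 0) 1 :: ('a, 'b) tsuv_poly)" for n :: nat and i :: int
    by (induction n)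
       (simp_all add: mult_single algebra_simps flip: single_one zero_prod_def)
  have inv: "Var_t * Poly_Mapping.single (-1, 0, 0, 0) 1 = (1 :: ('a, 'b) tsuv_poly)"
    by (simp add: Var_t_def mult_single flip: single_one zero_prod_def)
  have "(THE y. Var_t * y = (1 :: ('a, 'b) tsuv_poly)) = Poly_Mapping.single (-1, 0, 0, 0) 1"
    by (rule the_unit_inverse[OF inv])
  then show ?thesis
    by (simp add: unit_powi_def pow) (simp add: Var_t_def pow)
qed

lemma unit_powi_Var_s: "unit_powi Var_s k = Poly_Mapping.single (0, k, 0, 0) 1"
proof -
  have pow: "Poly_Mapping.single (0, i, 0, 0) (1::'b) ^ n =
      (Poly_Mapping.single (0, int n * i, 0, 0) 1 :: ('a, 'b) tsuv_poly)" for n :: nat and i :: int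
    by (induction n)
       (simp_all add: mult_single algebra_simps flip: single_one zero_prod_def)
  have inv: "Var_s * Poly_Mapping.single (0, -1, 0, 0) 1 = (1 :: ('a, 'b) tsuv_poly)"
    by (simp add: Var_s_def mult_single flip: single_one zero_prod_def)
  have "(THE y. Var_s * y = (1 :: ('a, 'b) tsuv_poly)) = Poly_Mapping.single (0, -1, 0, 0) 1"
    by (rule the_unit_inverse[OF inv])
  then show ?thesis
    by (simp add: unit_powi_def pow) (simp add: Var_s_def pow)
qed

lemma tutte_at_formula:
  fixes M :: "('e, 'r::comm_ring_1) rsm" and q :: "'k::comm_monoid_add \<Rightarrow>\<^sub>0 'r"
  assumes fin: "finite (ground M)"
  shows "tutte_at M q v =
    (\<Sum>A \<in> Pow (ground M). Const (mlt M A) * unit_powi q (- rank M A) * (\<Prod>e\<in>A. v e))"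
proof -
  define mon where "mon = (\<lambda>k :: int \<times> ('e \<Rightarrow>\<^sub>0 nat). unit_powi q (fst k) *
     (\<Prod>e \<in> Poly_Mapping.keys (snd k). v e ^ Poly_Mapping.lookup (snd k) e))"
  define F where "F = (\<lambda>A. Poly_Mapping.single
     (- rank M A, \<Sum>e\<in>A. Poly_Mapping.single e (1::nat)) (mlt M A))"
  have sub: "qv_subst p q v = (\<Sum>k\<in>K. Const (Poly_Mapping.lookup p k) * mon k)"
    if "finite K" "Poly_Mapping.keys p \<subseteq> K" for p K
    unfolding qv_subst_def mon_def mult.assoc using that
    by (intro sum.mono_neutral_left) (auto simp: Const_def in_keys_iff)
  have add: "qv_subst (p + p') q v = qv_subst p q v + qv_subst p' q v" for p p'
  proof -
    let ?K = "Poly_Mapping.keys p \<union> Poly_Mapping.keys p'"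
    have "Poly_Mapping.keys (p + p') \<subseteq> ?K" by (rule Poly_Mapping.keys_add)
    then show ?thesis
      by (simp add: sub[of ?K] lookup_add Const_def single_add distrib_right sum.distrib)
  qed
  have "qv_subst (\<Sum>A\<in>X. F A) q v = (\<Sum>A\<in>X. qv_subst (F A) q v)" if "finite X" for X
    using that by (induction X) (simp_all add: add, simp add: qv_subst_def)
  moreover have "qv_subst (F A) q v =
      Const (mlt M A) * unit_powi q (- rank M A) * (\<Prod>e\<in>A. v e)" if "A \<subseteq> ground M" for A
  proof -
    have fA: "finite A" using that fin finite_subset by blast
    have lk: "Poly_Mapping.lookup (\<Sum>e\<in>A. Poly_Mapping.single e (1::nat)) x = (if x \<in> A then 1 else 0)" for x
      using fA by (simp add: lookup_sum lookup_single when_def)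
    have "Poly_Mapping.keys (\<Sum>e\<in>A. Poly_Mapping.single e (1::nat)) = A"
      by (rule set_eqI) (simp only: in_keys_iff lk, simp)
    then have "mon (- rank M A, \<Sum>e\<in>A. Poly_Mapping.single e (1::nat)) =
        unit_powi q (- rank M A) * (\<Prod>e\<in>A. v e)"
      by (simp add: mon_def lk del: One_nat_def)
    then show ?thesis
      by (subst sub[of "{(- rank M A, \<Sum>e\<in>A. Poly_Mapping.single e (1::nat))}"])
         (auto simp: F_def mult.assoc split: if_splits)
  qed
  ultimately show ?thesis
    using fin by (simp add: tutte_at_def tutte_def F_def)
qed

end

theory Submission
  imports Defs
begin

text \<open>
  For fixed \<open>A\<close>, the monomial \<open>s\<^bsup>- r A\<^esup> \<Prod>e\<in>A. v e\<close> turns the contraction by \<open>A\<close> into the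
  part of the Tutte sum of \<open>m2\<close> indexed by the supersets \<open>D\<close> of \<open>A\<close>, because the powers of \<open>s\<close>
  telescope; the restriction to \<open>A\<close> is the part of the sum of \<open>m1\<close> indexed by the subsets \<open>B\<close> of
  \<open>A\<close>. The only remaining dependence on \<open>A\<close> is its sign, so inclusion-exclusion leaves just the
  terms with \<open>B = D\<close>, whose sign is cancelled by that of the variables \<open>- u e\<close>.
\<close>

lemma sum_alternating_subsets_supersets:
  fixes f h :: "'a set \<Rightarrow> 'b::ring_1"
  assumes "finite E"
  shows "(\<Sum>A\<in>Pow E. (-1) ^ card A * (\<Sum>B\<in>Pow A. f B) * (\<Sum>D | D \<in> Pow E \<and> A \<subseteq> D. h D)) =
    (\<Sum>D\<in>Pow E. (-1) ^ card D * f D * h D)"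
proof -
  have inversion: "(-1) ^ card D * f D = (\<Sum>A\<in>Pow D. (-1) ^ card A * (\<Sum>B\<in>Pow A. f B))"
    if "finite D" for D
    by (rule inclusion_exclusion_symmetric[OF _ that]) (simp flip: power_add mult.assoc)
  have "(\<Sum>A\<in>Pow E. (-1) ^ card A * (\<Sum>B\<in>Pow A. f B) * (\<Sum>D | D \<in> Pow E \<and> A \<subseteq> D. h D)) =
    (\<Sum>D\<in>Pow E. \<Sum>A | A \<in> Pow E \<and> A \<subseteq> D. (-1) ^ card A * (\<Sum>B\<in>Pow A. f B) * h D)"
    unfolding sum_distrib_left using assms by (intro sum.swap_restrict) auto
  also have "\<dots> = (\<Sum>D\<in>Pow E. \<Sum>A\<in>Pow D. (-1) ^ card A * (\<Sum>B\<in>Pow A. f B) * h D)"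
    by (intro sum.cong) auto
  also have "\<dots> = (\<Sum>D\<in>Pow E. (-1) ^ card D * f D * h D)"
    using assms by (intro sum.cong) (auto simp: inversion sum_distrib_right finite_subset)
  finally show ?thesis .
qed

lemma unit_powi_diff:
  fixes x y :: "'a::comm_ring_1"
  assumes "x * y = 1"
  shows "unit_powi x (int m - int n) = x ^ m * y ^ n"
proof (cases "n \<le> m")
  case True
  then have "x ^ m * y ^ n = x ^ (m - n) * (x * y) ^ n"
    by (simp add: power_mult_distrib flip: power_add mult.assoc)
  with True show ?thesis
    by (simp add: assms unit_powi_def nat_diff_distrib)
next
  case False
  then have "x ^ m * y ^ n = (x * y) ^ m * y ^ (n - m)"
    by (simp add: power_mult_distrib mult.assoc flip: power_add)
  with False show ?thesis
    by (simp add: assms unit_powi_def the_unit_inverse[OF assms] nat_diff_distrib)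
qed

lemma unit_powi_add:
  fixes x :: "'a::comm_ring_1"
  assumes "x dvd 1"
  shows "unit_powi x (i + j) = unit_powi x i * unit_powi x j"
proof -
  obtain y where y: "x * y = 1"
    using assms by (metis dvdE)
  obtain k l where i: "i = int k - int l"
    by (rule int_diff_cases)
  obtain m n where j: "j = int m - int n"
    by (rule int_diff_cases)
  have "i + j = int (k + m) - int (l + n)"
    by (simp add: i j)
  then have "unit_powi x (i + j) = x ^ (k + m) * y ^ (l + n)"
    by (simp only: unit_powi_diff[OF y])
  also have "\<dots> = unit_powi x i * unit_powi x j"
    by (simp add: i j unit_powi_diff[OF y] power_add ac_simps)
  finally show ?thesis .
qed

lemma unit_powi_mult_distrib:
  fixes x y :: "'a::comm_ring_1"
  assumes "x dvd 1" "y dvd 1"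
  shows "unit_powi (x * y) k = unit_powi x k * unit_powi y k"
proof -
  obtain x' y' where inverses: "x * x' = 1" "y * y' = 1"
    using assms by (metis dvdE)
  have "(x * y) * (x' * y') = (x * x') * (y * y')"
    by (simp only: ac_simps)
  then have "(x * y) * (x' * y') = 1"
    by (simp add: inverses)
  then show ?thesis
    using inverses by (simp add: unit_powi_def the_unit_inverse power_mult_distrib)
qed

lemma Const_mult:
  "Const (a * b) = (Const a * Const b :: 'k::comm_monoid_add \<Rightarrow>\<^sub>0 'r::comm_ring_1)"
  by (simp add: Const_def mult_single)

lemma Var_t_dvd_1: "Var_t dvd (1 :: ('e, 'r::comm_ring_1) tsuv_poly)"
proof (rule dvdI)
  show "1 = Var_t * (Poly_Mapping.single (-1, 0, 0, 0) 1 :: ('e, 'r) tsuv_poly)"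
    by (simp add: Var_t_def mult_single flip: single_one zero_prod_def)
qed

lemma Var_s_dvd_1: "Var_s dvd (1 :: ('e, 'r::comm_ring_1) tsuv_poly)"
proof (rule dvdI)
  show "1 = Var_s * (Poly_Mapping.single (0, -1, 0, 0) 1 :: ('e, 'r) tsuv_poly)"
    by (simp add: Var_s_def mult_single flip: single_one zero_prod_def)
qed

definition tutte_term ::
  "('e, 'r::comm_ring_1) rsm \<Rightarrow> ('k::comm_monoid_add \<Rightarrow>\<^sub>0 'r) \<Rightarrow> ('e \<Rightarrow> ('k \<Rightarrow>\<^sub>0 'r)) \<Rightarrow> 'e set \<Rightarrow> ('k \<Rightarrow>\<^sub>0 'r)"
where
  "tutte_term M q v A = Const (mlt M A) * unit_powi q (- rank M A) * (\<Prod>e\<in>A. v e)"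

lemma tutte_at_eq_sum_tutte_term:
  "finite (ground M) \<Longrightarrow> tutte_at M q v = (\<Sum>A\<in>Pow (ground M). tutte_term M q v A)"
  by (simp add: tutte_at_formula tutte_term_def)

lemma tutte_term_uminus: "tutte_term M q (\<lambda>e. - v e) A = (-1) ^ card A * tutte_term M q v A"
  by (simp add: tutte_term_def prod_uminus ac_simps)

lemma tutte_term_mult:
  assumes "p dvd 1" "q dvd 1"
  shows "tutte_term (RSM E r (\<lambda>A. m1 A * m2 A)) (p * q) (\<lambda>e. u e * v e) A =
    tutte_term (RSM E r m1) p u A * tutte_term (RSM E r m2) q v A"
  by (simp add: tutte_term_def Const_mult unit_powi_mult_distrib[OF assms] prod.distrib ac_simps)

lemma tutte_at_restrict:
  assumes "finite A"
  shows "tutte_at (rsm_restrict M A) q v = (\<Sum>B\<in>Pow A. tutte_term M q v B)"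
  using assms by (simp add: tutte_at_eq_sum_tutte_term rsm_restrict_def tutte_term_def)

lemma tutte_term_contract:
  assumes "finite D" "A \<subseteq> D" "D \<subseteq> ground M" "q dvd 1"
  shows "unit_powi q (- rank M A) * (\<Prod>e\<in>A. v e) * tutte_term (rsm_contract M A) q v (D - A) =
    tutte_term M q v D"
proof -
  have "D - A \<subseteq> ground M - A" and union: "D - A \<union> A = D"
    using assms by auto
  then have contract: "rank (rsm_contract M A) (D - A) = rank M D - rank M A"
    "mlt (rsm_contract M A) (D - A) = mlt M D"
    by (simp_all add: rsm_contract_def)
  have powers: "unit_powi q (- rank M D) =
      unit_powi q (- rank M A) * unit_powi q (- (rank M D - rank M A))"
    using unit_powi_add[OF assms(4), of "- rank M A" "- (rank M D - rank M A)"] by simp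
  have prods: "(\<Prod>e\<in>D. v e) = (\<Prod>e\<in>D - A. v e) * (\<Prod>e\<in>A. v e)"
    by (rule prod.subset_diff) (use assms in auto)
  show ?thesis
    unfolding tutte_term_def contract powers prods by (simp only: ac_simps)
qed

lemma tutte_at_contract:
  assumes "finite (ground M)" "A \<subseteq> ground M" "q dvd 1"
  shows "unit_powi q (- rank M A) * (\<Prod>e\<in>A. v e) * tutte_at (rsm_contract M A) q v =
    (\<Sum>D | D \<in> Pow (ground M) \<and> A \<subseteq> D. tutte_term M q v D)"
proof -
  have union_diff: "C \<union> A - A = C" if "C \<subseteq> ground M - A" for C
    using that by blast
  let ?monomial = "unit_powi q (- rank M A) * (\<Prod>e\<in>A. v e)"
  have "?monomial * tutte_at (rsm_contract M A) q v =
    (\<Sum>C\<in>Pow (ground M - A). ?monomial * tutte_term (rsm_contract M A) q v C)"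
    using assms(1)
    by (subst tutte_at_eq_sum_tutte_term) (simp_all add: rsm_contract_def sum_distrib_left)
  also have "\<dots> = (\<Sum>D | D \<in> Pow (ground M) \<and> A \<subseteq> D.
      ?monomial * tutte_term (rsm_contract M A) q v (D - A))"
    by (rule sum.reindex_bij_witness[of _ "\<lambda>D. D - A" "\<lambda>C. C \<union> A"])
       (use assms(2) in \<open>auto simp: union_diff\<close>)
  also have "\<dots> = (\<Sum>D | D \<in> Pow (ground M) \<and> A \<subseteq> D. tutte_term M q v D)"
    using assms by (intro sum.cong refl tutte_term_contract) (auto intro: finite_subset)
  finally show ?thesis .
qed

theorem tutte_at_convolution:
  fixes m1 m2 :: "'e set \<Rightarrow> 'r::comm_ring_1" and t s :: "'k::comm_monoid_add \<Rightarrow>\<^sub>0 'r"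
  assumes "finite E" "t dvd 1" "s dvd 1"
  shows "tutte_at (RSM E r (\<lambda>A. m1 A * m2 A)) (t * s) (\<lambda>e. u e * v e) =
    (\<Sum>A \<in> Pow E. unit_powi s (- r A) * (\<Prod>e\<in>A. - v e) *
       tutte_at (rsm_restrict (RSM E r m1) A) t (\<lambda>e. - u e) *
       tutte_at (rsm_contract (RSM E r m2) A) s v)"
proof -
  let ?lower = "tutte_term (RSM E r m1) t (\<lambda>e. - u e)" and ?upper = "tutte_term (RSM E r m2) s v"
  have summand: "unit_powi s (- r A) * (\<Prod>e\<in>A. - v e) *
      tutte_at (rsm_restrict (RSM E r m1) A) t (\<lambda>e. - u e) *
      tutte_at (rsm_contract (RSM E r m2) A) s v =
    (-1) ^ card A * (\<Sum>B\<in>Pow A. ?lower B) * (\<Sum>D | D \<in> Pow E \<and> A \<subseteq> D. ?upper D)"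
    if "A \<subseteq> E" for A
  proof -
    have "finite A"
      using that assms(1) by (rule finite_subset)
    moreover have "(\<Sum>D | D \<in> Pow E \<and> A \<subseteq> D. ?upper D) =
        unit_powi s (- r A) * (\<Prod>e\<in>A. v e) * tutte_at (rsm_contract (RSM E r m2) A) s v"
      using tutte_at_contract[of "RSM E r m2" A s v] assms that by simp
    ultimately show ?thesis
      by (simp only: tutte_at_restrict prod_uminus ac_simps)
  qed
  have "tutte_at (RSM E r (\<lambda>A. m1 A * m2 A)) (t * s) (\<lambda>e. u e * v e) =
      (\<Sum>D\<in>Pow E. (-1) ^ card D * ?lower D * ?upper D)"
    using assms by (simp add: tutte_at_eq_sum_tutte_term tutte_term_mult tutte_term_uminus)
  also have "\<dots> = (\<Sum>A\<in>Pow E. (-1) ^ card A * (\<Sum>B\<in>Pow A. ?lower B) *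
      (\<Sum>D | D \<in> Pow E \<and> A \<subseteq> D. ?upper D))"
    using assms(1) by (rule sum_alternating_subsets_supersets[symmetric])
  finally show ?thesis
    by (simp add: summand)
qed

theorem theorem3p10:
  fixes E :: "'e set" and r :: "'e set \<Rightarrow> int"
    and m1 m2 :: "'e set \<Rightarrow> 'r::comm_ring_1"
  assumes "finite E"
  shows "(tutte_at (RSM E r (\<lambda>A. m1 A * m2 A)) (Var_t * Var_s) (\<lambda>e. Var_u e * Var_v e)
           :: ('e, 'r) tsuv_poly) =
    (\<Sum>A \<in> Pow E. unit_powi Var_s (- r A) * (\<Prod>e\<in>A. - Var_v e) *
       tutte_at (rsm_restrict (RSM E r m1) A) Var_t (\<lambda>e. - Var_u e) *
       tutte_at (rsm_contract (RSM E r m2) A) Var_s Var_v)"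
  using assms Var_t_dvd_1 Var_s_dvd_1 by (rule tutte_at_convolution)

end
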